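(* The following data define a lax symmetric monoidal functor $\mathsf{Saddle}\colon(\mathbf{FinSet}/[2],+)\to(\mathbf{Set},\times)$. (i) An object $\tau\colon N\to[2]$ is sent to the set of functions $f\colon\mathbb{R}^N\to\mathbb{R}$ such that $f(u(\cdot,y))$ is convex for every fixed $y\in\mathbb{R}^{N_2}$ and $f(u(x,\cdot))$ is concave for every fixed $x\in\mathbb{R}^{N_1}$, where $N_1=\tau^{-1}(1)$, $N_2=\tau^{-1}(2)$ and $u\colon\mathbb{R}^{N_1}\oplus\mathbb{R}^{N_2}\cong\mathbb{R}^N$ is the canonical isomorphism. (ii) A morphism $\phi$ from $\tau_1\colon N\to[2]$ to $\tau_2\colon M\to[2]$ (that is, a function $\phi\colon N\to M$ with $\tau_2\circ\phi=\tau_1$) is sent to the function $\mathsf{Saddle}(\tau_1)\to\mathsf{Saddle}(\tau_2)$, $f\mapsto f\circ\phi^*$. (iii) For $\tau_1\colon N\to[2]$ and $\tau_2\colon M\to[2]$, the product comparison $\varphi_{\tau_1,\tau_2}\colon\mathsf{Saddle}(\tau_1)\times\mathsf{Saddle}(\tau_2)\to\mathsf{Saddle}(\tau_1+\tau_2)$ is $\varphi_{\tau_1,\tau_2}(f,g)(z)=f(\iota_N^*(z))+g(\iota_M^*(z))$ for all $z\in\mathbb{R}^{N+M}$. (iv) The unit comparison $\varphi_0\colon\{*\}\to\mathsf{Saddle}(\emptyset\xrightarrow{!}[2])$ is given by the constant $0$ function.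
   Context: $[2]=\{1,2\}$. $\mathbf{FinSet}/[2]$ is the slice category: objects are functions $\tau\colon N\to[2]$ from finite sets, morphisms $\tau_1\to\tau_2$ are functions $\phi$ between the domains with $\tau_2\circ\phi=\tau_1$. Its monoidal product $+$ is the coproduct: $\tau_1+\tau_2$ is the disjoint union $N+M$ equipped with the copairing $[\tau_1,\tau_2]\colon N+M\to[2]$; the unit is $\emptyset\to[2]$. $(\mathbf{Set},\times)$ has Cartesian product. For a finite set $N$, $\mathbb{R}^N$ is the vector space of functions $N\to\mathbb{R}$; for $\phi\colon N\to M$, $\phi^*\colon\mathbb{R}^M\to\mathbb{R}^N$ is $\phi^*(y)_i=y_{\phi(i)}$. $\iota_N,\iota_M$ are the inclusions of $N,M$ into $N+M$. Elements labelled $1$ are "convex" and those labelled $2$ are "concave"; the isomorphism $u\colon\mathbb{R}^{N_1}\oplus\mathbb{R}^{N_2}\to\mathbb{R}^N$ sends $(x,y)$ to the vector whose coordinate at $i\in N_1$ is $x_i$ and at $i\in N_2$ is $y_i$. *)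

theory Defs
  imports "HOL-Analysis.Convex" "HOL-Library.Function_Algebras"
begin

section \<open>Symmetric monoidal categories and lax symmetric monoidal functors\<close>

record ('o, 'm) category =
  Ob :: "'o set"
  Arr :: "'m set"
  Dom :: "'m \<Rightarrow> 'o"
  Cod :: "'m \<Rightarrow> 'o"
  Id :: "'o \<Rightarrow> 'm"
  Comp :: "'m \<Rightarrow> 'm \<Rightarrow> 'm"  (infixr "\<odot>\<index>" 55)

definition hom :: "('o, 'm, 'x) category_scheme \<Rightarrow> 'o \<Rightarrow> 'o \<Rightarrow> 'm set" where
  "hom C a b = {f \<in> Arr C. Dom C f = a \<and> Cod C f = b}"

locale category =
  fixes C :: "('o, 'm, 'x) category_scheme" (structure)
  assumes Dom_Ob: "f \<in> Arr C \<Longrightarrow> Dom C f \<in> Ob C"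
    and Cod_Ob: "f \<in> Arr C \<Longrightarrow> Cod C f \<in> Ob C"
    and Id_hom: "a \<in> Ob C \<Longrightarrow> Id C a \<in> hom C a a"
    and Comp_hom: "\<lbrakk>f \<in> hom C a b; g \<in> hom C b c\<rbrakk> \<Longrightarrow> g \<odot> f \<in> hom C a c"
    and Comp_Id: "f \<in> hom C a b \<Longrightarrow> f \<odot> Id C a = f"
    and Id_Comp: "f \<in> hom C a b \<Longrightarrow> Id C b \<odot> f = f"
    and Comp_assoc: "\<lbrakk>f \<in> hom C a b; g \<in> hom C b c; h \<in> hom C c d\<rbrakk>
      \<Longrightarrow> (h \<odot> g) \<odot> f = h \<odot> (g \<odot> f)"

definition iso :: "('o, 'm, 'x) category_scheme \<Rightarrow> 'o \<Rightarrow> 'o \<Rightarrow> 'm set" where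
  "iso C a b = {f \<in> hom C a b. \<exists>g \<in> hom C b a.
     Comp C g f = Id C a \<and> Comp C f g = Id C b}"

record ('o, 'm) monoidal_category = "('o, 'm) category" +
  tensor_ob :: "'o \<Rightarrow> 'o \<Rightarrow> 'o"  (infixr "\<otimes>\<index>" 70)
  tensor_arr :: "'m \<Rightarrow> 'm \<Rightarrow> 'm"  (infixr "\<boxtimes>\<index>" 70)
  unit_ob :: "'o"  ("\<I>\<index>")
  associator :: "'o \<Rightarrow> 'o \<Rightarrow> 'o \<Rightarrow> 'm"  ("\<alpha>\<index>")
  left_unitor :: "'o \<Rightarrow> 'm"  ("\<ell>\<index>")
  right_unitor :: "'o \<Rightarrow> 'm"  ("\<rho>\<index>")
  braiding :: "'o \<Rightarrow> 'o \<Rightarrow> 'm"  ("\<beta>\<index>")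

locale symmetric_monoidal_category = category C
  for C :: "('o, 'm, 'x) monoidal_category_scheme" (structure) +
  assumes tensor_Ob: "\<lbrakk>a \<in> Ob C; b \<in> Ob C\<rbrakk> \<Longrightarrow> a \<otimes> b \<in> Ob C"
    and tensor_hom: "\<lbrakk>f \<in> hom C a a'; g \<in> hom C b b'\<rbrakk>
      \<Longrightarrow> f \<boxtimes> g \<in> hom C (a \<otimes> b) (a' \<otimes> b')"
    and tensor_Id: "\<lbrakk>a \<in> Ob C; b \<in> Ob C\<rbrakk> \<Longrightarrow> Id C a \<boxtimes> Id C b = Id C (a \<otimes> b)"
    and tensor_Comp: "\<lbrakk>f \<in> hom C a a'; f' \<in> hom C a' a''; g \<in> hom C b b'; g' \<in> hom C b' b''\<rbrakk>
      \<Longrightarrow> (f' \<odot> f) \<boxtimes> (g' \<odot> g) = (f' \<boxtimes> g') \<odot> (f \<boxtimes> g)"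
    and unit_Ob: "\<I> \<in> Ob C"
    and associator_iso: "\<lbrakk>a \<in> Ob C; b \<in> Ob C; c \<in> Ob C\<rbrakk>
      \<Longrightarrow> \<alpha> a b c \<in> iso C ((a \<otimes> b) \<otimes> c) (a \<otimes> (b \<otimes> c))"
    and associator_natural: "\<lbrakk>f \<in> hom C a a'; g \<in> hom C b b'; h \<in> hom C c c'\<rbrakk>
      \<Longrightarrow> \<alpha> a' b' c' \<odot> ((f \<boxtimes> g) \<boxtimes> h) = (f \<boxtimes> (g \<boxtimes> h)) \<odot> \<alpha> a b c"
    and left_unitor_iso: "a \<in> Ob C \<Longrightarrow> \<ell> a \<in> iso C (\<I> \<otimes> a) a"
    and left_unitor_natural: "f \<in> hom C a a' \<Longrightarrow> \<ell> a' \<odot> (Id C \<I> \<boxtimes> f) = f \<odot> \<ell> a"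
    and right_unitor_iso: "a \<in> Ob C \<Longrightarrow> \<rho> a \<in> iso C (a \<otimes> \<I>) a"
    and right_unitor_natural: "f \<in> hom C a a' \<Longrightarrow> \<rho> a' \<odot> (f \<boxtimes> Id C \<I>) = f \<odot> \<rho> a"
    and braiding_hom: "\<lbrakk>a \<in> Ob C; b \<in> Ob C\<rbrakk> \<Longrightarrow> \<beta> a b \<in> hom C (a \<otimes> b) (b \<otimes> a)"
    and braiding_natural: "\<lbrakk>f \<in> hom C a a'; g \<in> hom C b b'\<rbrakk>
      \<Longrightarrow> \<beta> a' b' \<odot> (f \<boxtimes> g) = (g \<boxtimes> f) \<odot> \<beta> a b"
    and braiding_symmetric: "\<lbrakk>a \<in> Ob C; b \<in> Ob C\<rbrakk> \<Longrightarrow> \<beta> b a \<odot> \<beta> a b = Id C (a \<otimes> b)"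
    and pentagon: "\<lbrakk>a \<in> Ob C; b \<in> Ob C; c \<in> Ob C; d \<in> Ob C\<rbrakk>
      \<Longrightarrow> \<alpha> a b (c \<otimes> d) \<odot> \<alpha> (a \<otimes> b) c d
        = (Id C a \<boxtimes> \<alpha> b c d) \<odot> \<alpha> a (b \<otimes> c) d \<odot> (\<alpha> a b c \<boxtimes> Id C d)"
    and triangle: "\<lbrakk>a \<in> Ob C; b \<in> Ob C\<rbrakk>
      \<Longrightarrow> (Id C a \<boxtimes> \<ell> b) \<odot> \<alpha> a \<I> b = \<rho> a \<boxtimes> Id C b"
    and hexagon: "\<lbrakk>a \<in> Ob C; b \<in> Ob C; c \<in> Ob C\<rbrakk>
      \<Longrightarrow> \<alpha> b c a \<odot> \<beta> a (b \<otimes> c) \<odot> \<alpha> a b c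
        = (Id C b \<boxtimes> \<beta> a c) \<odot> \<alpha> b a c \<odot> (\<beta> a b \<boxtimes> Id C c)"

locale lax_symmetric_monoidal_functor =
  source: symmetric_monoidal_category C + target: symmetric_monoidal_category D
  for C :: "('o, 'm, 'x) monoidal_category_scheme" (structure)
    and D :: "('p, 'n, 'y) monoidal_category_scheme" (structure) +
  fixes F_ob :: "'o \<Rightarrow> 'p"
    and F_arr :: "'m \<Rightarrow> 'n"
    and mult :: "'o \<Rightarrow> 'o \<Rightarrow> 'n"
    and unit :: "'n"
  assumes F_Ob: "a \<in> Ob C \<Longrightarrow> F_ob a \<in> Ob D"
    and F_hom: "f \<in> hom C a b \<Longrightarrow> F_arr f \<in> hom D (F_ob a) (F_ob b)"
    and F_Id: "a \<in> Ob C \<Longrightarrow> F_arr (Id C a) = Id D (F_ob a)"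
    and F_Comp: "\<lbrakk>f \<in> hom C a b; g \<in> hom C b c\<rbrakk>
      \<Longrightarrow> F_arr (g \<odot>\<^bsub>C\<^esub> f) = F_arr g \<odot>\<^bsub>D\<^esub> F_arr f"
    and mult_hom: "\<lbrakk>a \<in> Ob C; b \<in> Ob C\<rbrakk>
      \<Longrightarrow> mult a b \<in> hom D (F_ob a \<otimes>\<^bsub>D\<^esub> F_ob b) (F_ob (a \<otimes>\<^bsub>C\<^esub> b))"
    and mult_natural: "\<lbrakk>f \<in> hom C a a'; g \<in> hom C b b'\<rbrakk>
      \<Longrightarrow> mult a' b' \<odot>\<^bsub>D\<^esub> (F_arr f \<boxtimes>\<^bsub>D\<^esub> F_arr g) = F_arr (f \<boxtimes>\<^bsub>C\<^esub> g) \<odot>\<^bsub>D\<^esub> mult a b"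
    and unit_hom: "unit \<in> hom D \<I>\<^bsub>D\<^esub> (F_ob \<I>\<^bsub>C\<^esub>)"
    and mult_associator: "\<lbrakk>a \<in> Ob C; b \<in> Ob C; c \<in> Ob C\<rbrakk>
      \<Longrightarrow> F_arr (\<alpha>\<^bsub>C\<^esub> a b c) \<odot>\<^bsub>D\<^esub> mult (a \<otimes>\<^bsub>C\<^esub> b) c \<odot>\<^bsub>D\<^esub> (mult a b \<boxtimes>\<^bsub>D\<^esub> Id D (F_ob c))
        = mult a (b \<otimes>\<^bsub>C\<^esub> c) \<odot>\<^bsub>D\<^esub> (Id D (F_ob a) \<boxtimes>\<^bsub>D\<^esub> mult b c)
            \<odot>\<^bsub>D\<^esub> \<alpha>\<^bsub>D\<^esub> (F_ob a) (F_ob b) (F_ob c)"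
    and unit_left: "a \<in> Ob C
      \<Longrightarrow> F_arr (\<ell>\<^bsub>C\<^esub> a) \<odot>\<^bsub>D\<^esub> mult \<I>\<^bsub>C\<^esub> a \<odot>\<^bsub>D\<^esub> (unit \<boxtimes>\<^bsub>D\<^esub> Id D (F_ob a)) = \<ell>\<^bsub>D\<^esub> (F_ob a)"
    and unit_right: "a \<in> Ob C
      \<Longrightarrow> F_arr (\<rho>\<^bsub>C\<^esub> a) \<odot>\<^bsub>D\<^esub> mult a \<I>\<^bsub>C\<^esub> \<odot>\<^bsub>D\<^esub> (Id D (F_ob a) \<boxtimes>\<^bsub>D\<^esub> unit) = \<rho>\<^bsub>D\<^esub> (F_ob a)"
    and mult_braiding: "\<lbrakk>a \<in> Ob C; b \<in> Ob C\<rbrakk>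
      \<Longrightarrow> F_arr (\<beta>\<^bsub>C\<^esub> a b) \<odot>\<^bsub>D\<^esub> mult a b = mult b a \<odot>\<^bsub>D\<^esub> \<beta>\<^bsub>D\<^esub> (F_ob a) (F_ob b)"

text \<open>An arrow of a concrete category: source, target and underlying function. Functions on a set
  are always taken extensional (value \<^const>\<open>undefined\<close> outside that set), so that equality
  of arrows is equality of functions.\<close>

datatype ('o, 'f) arrow = Arrow (src: 'o) (tgt: 'o) (app: 'f)


section \<open>The category of finite sets over \<open>[2]\<close>\<close>

text \<open>Finite sets are finite subsets of a type of points which is closed under
  tagged disjoint union and contains an arbitrary type \<^typ>\<open>'a\<close>.\<close>

datatype 'a point = Atom 'a | InL "'a point" | InR "'a point"

definition disjoint_sum :: "'a point set \<Rightarrow> 'a point set \<Rightarrow> 'a point set" where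
  "disjoint_sum N M = InL ` N \<union> InR ` M"

definition copair :: "'a point set \<Rightarrow> 'a point set \<Rightarrow> ('a point \<Rightarrow> 'b) \<Rightarrow> ('a point \<Rightarrow> 'b)
    \<Rightarrow> ('a point \<Rightarrow> 'b)" where
  "copair N M f g =
    restrict (\<lambda>k. case k of InL i \<Rightarrow> f i | InR j \<Rightarrow> g j) (disjoint_sum N M)"

text \<open>An object is a pair of a finite set \<open>N\<close> and a function \<open>\<tau>\<close> from \<open>N\<close> to \<open>{1, 2}\<close>.\<close>

type_synonym 'a over2 = "'a point set \<times> ('a point \<Rightarrow> nat)"
type_synonym 'a over2_arrow = "('a over2, 'a point \<Rightarrow> 'a point) arrow"

definition over2_obs :: "'a over2 set" where
  "over2_obs = {(N, \<tau>). finite N \<and> \<tau> \<in> N \<rightarrow>\<^sub>E {1, 2}}"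

definition over2_arrs :: "'a over2_arrow set" where
  "over2_arrs = {Arrow (N, \<tau>\<^sub>1) (M, \<tau>\<^sub>2) \<phi> | N \<tau>\<^sub>1 M \<tau>\<^sub>2 \<phi>.
     (N, \<tau>\<^sub>1) \<in> over2_obs \<and> (M, \<tau>\<^sub>2) \<in> over2_obs \<and> \<phi> \<in> N \<rightarrow>\<^sub>E M \<and> compose N \<tau>\<^sub>2 \<phi> = \<tau>\<^sub>1}"

definition over2_sum :: "'a over2 \<Rightarrow> 'a over2 \<Rightarrow> 'a over2" where
  "over2_sum S T = (disjoint_sum (fst S) (fst T), copair (fst S) (fst T) (snd S) (snd T))"

definition over2_empty :: "'a over2" where
  "over2_empty = ({}, \<lambda>_. undefined)"

definition FinSet_over2 :: "('a over2, 'a over2_arrow) monoidal_category" where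
  "FinSet_over2 = \<lparr>
     Ob = over2_obs,
     Arr = over2_arrs,
     Dom = src,
     Cod = tgt,
     Id = (\<lambda>T. Arrow T T (\<lambda>i\<in>fst T. i)),
     Comp = (\<lambda>g f. Arrow (src f) (tgt g) (compose (fst (src f)) (app g) (app f))),
     tensor_ob = over2_sum,
     tensor_arr = (\<lambda>f g. Arrow (over2_sum (src f) (src g)) (over2_sum (tgt f) (tgt g))
        (copair (fst (src f)) (fst (src g)) (InL \<circ> app f) (InR \<circ> app g))),
     unit_ob = over2_empty,
     associator = (\<lambda>S T U. Arrow (over2_sum (over2_sum S T) U) (over2_sum S (over2_sum T U))
        (copair (disjoint_sum (fst S) (fst T)) (fst U)
           (copair (fst S) (fst T) InL (InR \<circ> InL)) (InR \<circ> InR))),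
     left_unitor = (\<lambda>T. Arrow (over2_sum over2_empty T) T
        (copair {} (fst T) (\<lambda>_. undefined) (\<lambda>i. i))),
     right_unitor = (\<lambda>T. Arrow (over2_sum T over2_empty) T
        (copair (fst T) {} (\<lambda>i. i) (\<lambda>_. undefined))),
     braiding = (\<lambda>S T. Arrow (over2_sum S T) (over2_sum T S)
        (copair (fst S) (fst T) InR InL)) \<rparr>"


section \<open>The category of sets with Cartesian product\<close>

text \<open>The objects are the sets of elements of a type closed under pairing and
  containing a point and an arbitrary type \<^typ>\<open>'e\<close>.\<close>

datatype 'e element = Elem 'e | Star | Tup "'e element" "'e element"

type_synonym 'e set_arrow = "('e element set, 'e element \<Rightarrow> 'e element) arrow"

definition cartesian :: "'e element set \<Rightarrow> 'e element set \<Rightarrow> 'e element set" where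
  "cartesian A B = {Tup a b | a b. a \<in> A \<and> b \<in> B}"

definition Set_category :: "('e element set, 'e set_arrow) monoidal_category" where
  "Set_category = \<lparr>
     Ob = UNIV,
     Arr = {Arrow A B f | A B f. f \<in> A \<rightarrow>\<^sub>E B},
     Dom = src,
     Cod = tgt,
     Id = (\<lambda>A. Arrow A A (\<lambda>x\<in>A. x)),
     Comp = (\<lambda>g f. Arrow (src f) (tgt g) (compose (src f) (app g) (app f))),
     tensor_ob = cartesian,
     tensor_arr = (\<lambda>f g. Arrow (cartesian (src f) (src g)) (cartesian (tgt f) (tgt g))
        (\<lambda>z\<in>cartesian (src f) (src g). case z of Tup a b \<Rightarrow> Tup (app f a) (app g b))),
     unit_ob = {Star},
     associator = (\<lambda>A B C. Arrow (cartesian (cartesian A B) C) (cartesian A (cartesian B C))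
        (\<lambda>z\<in>cartesian (cartesian A B) C. case z of Tup (Tup a b) c \<Rightarrow> Tup a (Tup b c))),
     left_unitor = (\<lambda>A. Arrow (cartesian {Star} A) A
        (\<lambda>z\<in>cartesian {Star} A. case z of Tup _ a \<Rightarrow> a)),
     right_unitor = (\<lambda>A. Arrow (cartesian A {Star}) A
        (\<lambda>z\<in>cartesian A {Star}. case z of Tup a _ \<Rightarrow> a)),
     braiding = (\<lambda>A B. Arrow (cartesian A B) (cartesian B A)
        (\<lambda>z\<in>cartesian A B. case z of Tup a b \<Rightarrow> Tup b a)) \<rparr>"


section \<open>Saddle functions\<close>

instantiation "fun" :: (type, real_vector) real_vector
begin

definition scaleR_fun :: "real \<Rightarrow> ('a \<Rightarrow> 'b) \<Rightarrow> 'a \<Rightarrow> 'b" where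
  "scaleR_fun c f = (\<lambda>x. c *\<^sub>R f x)"

instance
  by standard (simp_all add: scaleR_fun_def fun_eq_iff scaleR_add_right scaleR_add_left)

end

text \<open>The vector space \<open>\<real>\<^sup>N\<close>. Here, in contrast to the functions
  above, vectors are extended by zero outside \<open>N\<close>, which makes \<open>\<real>\<^sup>N\<close> a linear subspace of
  the real vector space of all functions.\<close>

definition Rn :: "'i set \<Rightarrow> ('i \<Rightarrow> real) set" where
  "Rn N = {x. \<forall>i. i \<notin> N \<longrightarrow> x i = 0}"

definition pullback :: "'i set \<Rightarrow> ('i \<Rightarrow> 'j) \<Rightarrow> ('j \<Rightarrow> real) \<Rightarrow> ('i \<Rightarrow> real)" where
  "pullback N \<phi> y = (\<lambda>i. if i \<in> N then y (\<phi> i) else 0)"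

text \<open>For disjoint \<open>N\<^sub>1\<close> and \<open>N\<^sub>2\<close>, this is the canonical isomorphism \<open>u\<close>:
  \<^term>\<open>Rn N\<^sub>1\<close> \<open>\<oplus>\<close> \<^term>\<open>Rn N\<^sub>2\<close> \<open>\<cong>\<close> \<^term>\<open>Rn (N\<^sub>1 \<union> N\<^sub>2)\<close>.\<close>

definition join :: "'i set \<Rightarrow> 'i set \<Rightarrow> ('i \<Rightarrow> real) \<Rightarrow> ('i \<Rightarrow> real) \<Rightarrow> ('i \<Rightarrow> real)" where
  "join N\<^sub>1 N\<^sub>2 x y = (\<lambda>i. if i \<in> N\<^sub>1 then x i else if i \<in> N\<^sub>2 then y i else 0)"

definition label_fibre :: "'a over2 \<Rightarrow> nat \<Rightarrow> 'a point set" where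
  "label_fibre T l = {i \<in> fst T. snd T i = l}"

definition saddle_functions :: "'a over2 \<Rightarrow> (('a point \<Rightarrow> real) \<Rightarrow> real) set" where
  "saddle_functions T = {f \<in> extensional (Rn (fst T)).
     let N\<^sub>1 = label_fibre T 1; N\<^sub>2 = label_fibre T 2; u = join N\<^sub>1 N\<^sub>2 in
       (\<forall>y \<in> Rn N\<^sub>2. convex_on (Rn N\<^sub>1) (\<lambda>x. f (u x y))) \<and>
       (\<forall>x \<in> Rn N\<^sub>1. concave_on (Rn N\<^sub>2) (\<lambda>y. f (u x y)))}"

text \<open>Saddle functions are regarded as elements of the objects of \<^const>\<open>Set_category\<close>
  through the injection \<^term>\<open>Fn\<close>; the type \<^typ>\<open>'b\<close> is arbitrary and only makes
  the universe of sets as large as desired.\<close>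

type_synonym ('a, 'b) saddle_element = "((('a point \<Rightarrow> real) \<Rightarrow> real) + 'b) element"
type_synonym ('a, 'b) saddle_arrow = "((('a point \<Rightarrow> real) \<Rightarrow> real) + 'b) set_arrow"

abbreviation Fn :: "(('a point \<Rightarrow> real) \<Rightarrow> real) \<Rightarrow> ('a, 'b) saddle_element" where
  "Fn f \<equiv> Elem (Inl f)"

definition saddle_ob :: "'a over2 \<Rightarrow> ('a, 'b) saddle_element set" where
  "saddle_ob T = Fn ` saddle_functions T"

definition saddle_arr :: "'a over2_arrow \<Rightarrow> ('a, 'b) saddle_arrow" where
  "saddle_arr \<phi> = Arrow (saddle_ob (src \<phi>)) (saddle_ob (tgt \<phi>))
     (\<lambda>z\<in>saddle_ob (src \<phi>). case z of Fn f \<Rightarrow>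
        Fn (compose (Rn (fst (tgt \<phi>))) f (pullback (fst (src \<phi>)) (app \<phi>))))"

definition saddle_mult :: "'a over2 \<Rightarrow> 'a over2 \<Rightarrow> ('a, 'b) saddle_arrow" where
  "saddle_mult S T = Arrow
     (cartesian (saddle_ob S) (saddle_ob T)) (saddle_ob (over2_sum S T))
     (\<lambda>p\<in>cartesian (saddle_ob S) (saddle_ob T). case p of Tup (Fn f) (Fn g) \<Rightarrow>
        Fn (\<lambda>z\<in>Rn (disjoint_sum (fst S) (fst T)).
          f (pullback (fst S) InL z) + g (pullback (fst T) InR z)))"

definition saddle_unit :: "('a, 'b) saddle_arrow" where
  "saddle_unit = Arrow {Star} (saddle_ob over2_empty) (\<lambda>_\<in>{Star}. Fn (\<lambda>z\<in>Rn {}. 0))"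

end

theory Submission
  imports Defs
begin

text \<open>
  Two observations make the saddle functions into a functor. Pulling back along
  \<open>\<phi>: N \<rightarrow> M\<close> is a linear map from \<open>\<real>\<^sup>M\<close> to \<open>\<real>\<^sup>N\<close>, and when \<open>\<phi>\<close> preserves
  labels this map respects the splittings into a convex and a concave block: it is the
  direct sum of the pullbacks along the two restrictions of \<open>\<phi>\<close> to the fibres
  (\<open>pullback_join\<close>). Since a convex (or concave) function precomposed with a linear map
  is again convex (or concave), \<open>f \<circ> \<phi>\<^sup>*\<close> is a saddle function whenever \<open>f\<close> is one
  (\<open>saddle_shaped_pullback\<close>).

  The product comparison needs no new argument. The two inclusions into a disjoint sum are
  label preserving, so both summands of \<open>f (\<iota>\<^sub>N\<^sup>* z) + g (\<iota>\<^sub>M\<^sup>* z)\<close> are saddle functions of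
  \<open>z\<close> by the first step, and saddle functions are closed under pointwise addition
  (\<open>saddle_shaped_add\<close>, \<open>external_sum_saddle\<close>).

  All coherence laws then come down to contravariant functoriality of the pullback. After
  composing pullbacks, both sides evaluate \<open>f\<close>, \<open>g\<close>, \<open>h\<close> at the same restrictions of the
  argument, and what remains is that addition of real numbers is associative,
  commutative and has unit \<open>0\<close> (\<open>external_sum_natural\<close> and the lemmas after it).

  That the source and the target are symmetric monoidal categories is checked on elements. Both
  are concrete: an arrow with given source and target is determined by the
  values of its underlying function, so every axiom reduces to a case distinction on tags
  or on tuples.
\<close>

section \<open>Concrete categories\<close>

text \<open>
  The common part of the two categories at hand: arrows are triples of a source, a target and
  an extensional function between the carriers. The category laws are inherited from
  functions; specific to each case is that the admissible functions (the label
  preserving ones, or all of them) are closed under identities and composition.\<close>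

locale concrete_category =
  fixes C :: "('o, ('o, 'e \<Rightarrow> 'e) arrow, 'x) category_scheme" (structure)
    and carr :: "'o \<Rightarrow> 'e set"
  assumes Dom_eq: "Dom C = src"
    and Cod_eq: "Cod C = tgt"
    and Id_eq: "Id C a = Arrow a a (\<lambda>x\<in>carr a. x)"
    and Comp_eq: "g \<odot> f = Arrow (src f) (tgt g) (compose (carr (src f)) (app g) (app f))"
    and src_Ob: "f \<in> Arr C \<Longrightarrow> src f \<in> Ob C"
    and tgt_Ob: "f \<in> Arr C \<Longrightarrow> tgt f \<in> Ob C"
    and app_PiE: "f \<in> Arr C \<Longrightarrow> app f \<in> carr (src f) \<rightarrow>\<^sub>E carr (tgt f)"
    and Id_Arr: "a \<in> Ob C \<Longrightarrow> Id C a \<in> Arr C"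
    and Comp_Arr: "\<lbrakk>f \<in> Arr C; g \<in> Arr C; tgt f = src g\<rbrakk> \<Longrightarrow> g \<odot> f \<in> Arr C"
begin

lemma hom_iff: "f \<in> hom C a b \<longleftrightarrow> f \<in> Arr C \<and> src f = a \<and> tgt f = b"
  by (auto simp: hom_def Dom_eq Cod_eq)

lemma app_mem: "\<lbrakk>f \<in> hom C a b; x \<in> carr a\<rbrakk> \<Longrightarrow> app f x \<in> carr b"
  using app_PiE by (fastforce simp: hom_iff)

text \<open>
  The faithfulness of the carrier functor. It turns every equation between parallel arrows into
  a pointwise one.\<close>

lemma arrow_eqI:
  assumes "f \<in> hom C a b" "g \<in> hom C a b" "\<And>x. x \<in> carr a \<Longrightarrow> app f x = app g x"
  shows "f = g"
proof (rule arrow.expand)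
  have "app f = app g"
    using assms app_PiE[of f] app_PiE[of g] by (auto simp: hom_iff intro: PiE_ext)
  then show "src f = src g \<and> tgt f = tgt g \<and> app f = app g"
    using assms by (simp add: hom_iff)
qed

lemma app_Comp: "x \<in> carr (src f) \<Longrightarrow> app (g \<odot> f) x = app g (app f x)"
  by (simp add: Comp_eq compose_eq)

lemma app_Id: "x \<in> carr a \<Longrightarrow> app (Id C a) x = x"
  by (simp add: Id_eq)

lemma src_Comp: "src (g \<odot> f) = src f"
  by (simp add: Comp_eq)

lemma Id_in_hom: "a \<in> Ob C \<Longrightarrow> Id C a \<in> hom C a a"
  using Id_Arr by (simp add: hom_iff) (simp add: Id_eq)

lemma Comp_in_hom: "\<lbrakk>f \<in> hom C a b; g \<in> hom C b c\<rbrakk> \<Longrightarrow> g \<odot> f \<in> hom C a c"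
  using Comp_Arr by (simp add: hom_iff) (simp add: Comp_eq)

sublocale category C
proof
  fix f a b assume f: "f \<in> hom C a b"
  have ob: "a \<in> Ob C" "b \<in> Ob C"
    using f src_Ob tgt_Ob by (auto simp: hom_iff)
  show "f \<odot> Id C a = f"
    by (rule arrow_eqI[OF Comp_in_hom[OF Id_in_hom[OF ob(1)] f] f])
      (simp add: app_Comp app_Id Id_eq)
  show "Id C b \<odot> f = f"
    by (rule arrow_eqI[OF Comp_in_hom[OF f Id_in_hom[OF ob(2)]] f])
      (use f app_mem[OF f] in \<open>simp add: app_Comp app_Id hom_iff\<close>)
next
  fix f g h a b c d
  assume fgh: "f \<in> hom C a b" "g \<in> hom C b c" "h \<in> hom C c d"
  show "(h \<odot> g) \<odot> f = h \<odot> g \<odot> f"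
    by (rule arrow_eqI[OF Comp_in_hom[OF fgh(1) Comp_in_hom[OF fgh(2,3)]]
          Comp_in_hom[OF Comp_in_hom[OF fgh(1,2)] fgh(3)]])
      (use fgh app_mem[OF fgh(1)] in \<open>simp add: app_Comp src_Comp hom_iff\<close>)
qed (auto simp: Dom_eq Cod_eq src_Ob tgt_Ob Id_in_hom Comp_in_hom)

lemma isoI:
  assumes "f \<in> hom C a b" "g \<in> hom C b a"
    and "\<And>x. x \<in> carr a \<Longrightarrow> app g (app f x) = x" "\<And>y. y \<in> carr b \<Longrightarrow> app f (app g y) = y"
  shows "f \<in> iso C a b"
proof -
  have ob: "a \<in> Ob C" "b \<in> Ob C"
    using assms(1) src_Ob tgt_Ob by (auto simp: hom_iff)
  have "g \<odot> f = Id C a"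
    by (rule arrow_eqI[OF Comp_in_hom[OF assms(1,2)] Id_in_hom[OF ob(1)]])
      (use assms in \<open>simp add: app_Comp app_Id hom_iff\<close>)
  moreover have "f \<odot> g = Id C b"
    by (rule arrow_eqI[OF Comp_in_hom[OF assms(2,1)] Id_in_hom[OF ob(2)]])
      (use assms in \<open>simp add: app_Comp app_Id hom_iff\<close>)
  ultimately show ?thesis
    using assms(1,2) by (auto simp: iso_def)
qed

end


section \<open>Finite sets over a two-element set\<close>

lemma over2_sel:
  "Ob FinSet_over2 = over2_obs" "Arr FinSet_over2 = over2_arrs"
  "Dom FinSet_over2 = src" "Cod FinSet_over2 = tgt"
  "Id FinSet_over2 T = Arrow T T (\<lambda>i\<in>fst T. i)"
  "Comp FinSet_over2 g f = Arrow (src f) (tgt g) (compose (fst (src f)) (app g) (app f))"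
  "tensor_ob FinSet_over2 = over2_sum"
  "unit_ob FinSet_over2 = over2_empty"
  by (simp_all add: FinSet_over2_def)

lemma over2_structure:
  "tensor_arr FinSet_over2 f g = Arrow (over2_sum (src f) (src g)) (over2_sum (tgt f) (tgt g))
    (copair (fst (src f)) (fst (src g)) (InL \<circ> app f) (InR \<circ> app g))"
  "associator FinSet_over2 S T U = Arrow (over2_sum (over2_sum S T) U) (over2_sum S (over2_sum T U))
    (copair (disjoint_sum (fst S) (fst T)) (fst U)
       (copair (fst S) (fst T) InL (InR \<circ> InL)) (InR \<circ> InR))"
  "left_unitor FinSet_over2 T = Arrow (over2_sum over2_empty T) T
    (copair {} (fst T) (\<lambda>_. undefined) (\<lambda>i. i))"
  "right_unitor FinSet_over2 T = Arrow (over2_sum T over2_empty) T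
    (copair (fst T) {} (\<lambda>i. i) (\<lambda>_. undefined))"
  "braiding FinSet_over2 S T = Arrow (over2_sum S T) (over2_sum T S)
    (copair (fst S) (fst T) InR InL)"
  by (simp_all add: FinSet_over2_def)

text \<open>
  Extensionality of the labelling of the source turns the equation of functions
  \<open>\<tau>\<^sub>2 \<circ> \<phi> = \<tau>\<^sub>1\<close> into a condition on the elements of the source only.\<close>

lemma over2_arrs_iff:
  "f \<in> over2_arrs \<longleftrightarrow> src f \<in> over2_obs \<and> tgt f \<in> over2_obs
     \<and> app f \<in> fst (src f) \<rightarrow>\<^sub>E fst (tgt f)
     \<and> (\<forall>i\<in>fst (src f). snd (tgt f) (app f i) = snd (src f) i)"
proof (cases f)
  case (Arrow S T \<phi>)
  have "compose (fst S) (snd T) \<phi> = snd S \<longleftrightarrow> (\<forall>i\<in>fst S. snd T (\<phi> i) = snd S i)"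
    if "S \<in> over2_obs"
    using that by (auto simp: over2_obs_def compose_def fun_eq_iff PiE_def extensional_def)
  then show ?thesis
    by (cases S; cases T) (auto simp: over2_arrs_def Arrow)
qed

interpretation over2: concrete_category FinSet_over2 fst
proof
  fix f g :: "'a over2_arrow"
  assume "f \<in> Arr FinSet_over2" "g \<in> Arr FinSet_over2" "tgt f = src g"
  then show "g \<odot>\<^bsub>FinSet_over2\<^esub> f \<in> Arr FinSet_over2"
    by (simp add: over2_sel over2_arrs_iff compose_def PiE_iff Pi_iff)
qed (auto simp: over2_sel over2_arrs_iff)

lemma over2_homI:
  assumes "S \<in> over2_obs" "T \<in> over2_obs" "\<phi> \<in> extensional (fst S)"
    and "\<And>i. i \<in> fst S \<Longrightarrow> \<phi> i \<in> fst T \<and> snd T (\<phi> i) = snd S i"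
  shows "Arrow S T \<phi> \<in> hom FinSet_over2 S T"
  using assms by (simp add: over2.hom_iff over2_sel over2_arrs_iff PiE_def)

lemma over2_homD:
  assumes "f \<in> hom FinSet_over2 S T"
  shows "S \<in> over2_obs" "T \<in> over2_obs" "src f = S" "tgt f = T"
    and "\<And>i. i \<in> fst S \<Longrightarrow> app f i \<in> fst T"
    and "\<And>i. i \<in> fst S \<Longrightarrow> snd T (app f i) = snd S i"
  using assms by (auto simp: over2.hom_iff over2_sel over2_arrs_iff)

lemma disjoint_sum_mem [simp]:
  "InL i \<in> disjoint_sum N M \<longleftrightarrow> i \<in> N" "InR j \<in> disjoint_sum N M \<longleftrightarrow> j \<in> M"
  by (auto simp: disjoint_sum_def)

lemma disjoint_sumE:
  assumes "k \<in> disjoint_sum N M"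
  obtains i where "k = InL i" "i \<in> N" | j where "k = InR j" "j \<in> M"
  using assms by (auto simp: disjoint_sum_def)

lemma copair_simps [simp]:
  "i \<in> N \<Longrightarrow> copair N M f g (InL i) = f i" "j \<in> M \<Longrightarrow> copair N M f g (InR j) = g j"
  by (simp_all add: copair_def)

lemma copair_extensional [simp]: "copair N M f g \<in> extensional (disjoint_sum N M)"
  by (simp add: copair_def)

lemma over2_sum_sel [simp]:
  "fst (over2_sum S T) = disjoint_sum (fst S) (fst T)"
  "snd (over2_sum S T) = copair (fst S) (fst T) (snd S) (snd T)"
  "fst over2_empty = {}"
  by (simp_all add: over2_sum_def over2_empty_def)

lemma over2_sum_obs: "\<lbrakk>S \<in> over2_obs; T \<in> over2_obs\<rbrakk> \<Longrightarrow> over2_sum S T \<in> over2_obs"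
  by (cases S; cases T)
    (auto simp: over2_obs_def over2_sum_def disjoint_sum_def copair_def PiE_iff extensional_def)

lemma over2_empty_obs: "over2_empty \<in> over2_obs"
  by (simp add: over2_obs_def over2_empty_def)

lemma over2_tensor_hom:
  assumes "f \<in> hom FinSet_over2 S S'" "g \<in> hom FinSet_over2 T T'"
  shows "tensor_arr FinSet_over2 f g \<in> hom FinSet_over2 (over2_sum S T) (over2_sum S' T')"
  unfolding over2_structure over2_homD[OF assms(1)] over2_homD[OF assms(2)]
  by (rule over2_homI)
    (use over2_homD[OF assms(1)] over2_homD[OF assms(2)] in
      \<open>auto intro: over2_sum_obs elim!: disjoint_sumE\<close>)

lemma over2_structure_hom:
  "\<lbrakk>S \<in> over2_obs; T \<in> over2_obs; U \<in> over2_obs\<rbrakk> \<Longrightarrow> associator FinSet_over2 S T U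
      \<in> hom FinSet_over2 (over2_sum (over2_sum S T) U) (over2_sum S (over2_sum T U))"
  "T \<in> over2_obs \<Longrightarrow> left_unitor FinSet_over2 T \<in> hom FinSet_over2 (over2_sum over2_empty T) T"
  "T \<in> over2_obs \<Longrightarrow> right_unitor FinSet_over2 T \<in> hom FinSet_over2 (over2_sum T over2_empty) T"
  "\<lbrakk>S \<in> over2_obs; T \<in> over2_obs\<rbrakk> \<Longrightarrow>
    braiding FinSet_over2 S T \<in> hom FinSet_over2 (over2_sum S T) (over2_sum T S)"
  unfolding over2_structure
  by (rule over2_homI; auto intro: over2_sum_obs over2_empty_obs elim!: disjoint_sumE
        simp: extensional_def copair_def disjoint_sum_def)+

lemmas over2_hom_intros =
  over2.Comp_in_hom over2_tensor_hom over2_structure_hom over2.Id_in_hom[unfolded over2_sel(1)]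
  over2_sum_obs over2_empty_obs

lemma over2_associator_iso:
  assumes "S \<in> over2_obs" "T \<in> over2_obs" "U \<in> over2_obs"
  shows "associator FinSet_over2 S T U
    \<in> iso FinSet_over2 (over2_sum (over2_sum S T) U) (over2_sum S (over2_sum T U))"
proof -
  have "Arrow (over2_sum S (over2_sum T U)) (over2_sum (over2_sum S T) U)
      (copair (fst S) (disjoint_sum (fst T) (fst U))
        (InL \<circ> InL) (copair (fst T) (fst U) (InL \<circ> InR) InR))
    \<in> hom FinSet_over2 (over2_sum S (over2_sum T U)) (over2_sum (over2_sum S T) U)"
    by (rule over2_homI) (use assms in \<open>auto intro: over2_sum_obs elim!: disjoint_sumE\<close>)
  then show ?thesis
    by (rule over2.isoI[OF over2_structure_hom(1)[OF assms]])
      (auto simp: over2_structure elim!: disjoint_sumE)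
qed

lemma over2_left_unitor_iso:
  assumes "T \<in> over2_obs"
  shows "left_unitor FinSet_over2 T \<in> iso FinSet_over2 (over2_sum over2_empty T) T"
proof -
  have "Arrow T (over2_sum over2_empty T) (\<lambda>i\<in>fst T. InR i)
    \<in> hom FinSet_over2 T (over2_sum over2_empty T)"
    by (rule over2_homI) (use assms in \<open>auto intro: over2_sum_obs over2_empty_obs\<close>)
  then show ?thesis
    by (rule over2.isoI[OF over2_structure_hom(2)[OF assms]])
      (auto simp: over2_structure elim!: disjoint_sumE)
qed

lemma over2_right_unitor_iso:
  assumes "T \<in> over2_obs"
  shows "right_unitor FinSet_over2 T \<in> iso FinSet_over2 (over2_sum T over2_empty) T"
proof -
  have "Arrow T (over2_sum T over2_empty) (\<lambda>i\<in>fst T. InL i)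
    \<in> hom FinSet_over2 T (over2_sum T over2_empty)"
    by (rule over2_homI) (use assms in \<open>auto intro: over2_sum_obs over2_empty_obs\<close>)
  then show ?thesis
    by (rule over2.isoI[OF over2_structure_hom(3)[OF assms]])
      (auto simp: over2_structure elim!: disjoint_sumE)
qed

text \<open>
  In each equational axiom, the common source and target of the two sides are found by
  chaining the typing rules \<open>over2_hom_intros\<close>. On an element, the structure maps only move the
  tags \<open>InL\<close> and \<open>InR\<close>, and both sides end with the same tags.\<close>

lemma FinSet_over2_symmetric_monoidal: "symmetric_monoidal_category FinSet_over2"
proof (unfold_locales, unfold over2_sel(1,7,8))
  fix f f' g g' :: "'a over2_arrow" and a a' a'' b b' b''
  assume fg: "f \<in> hom FinSet_over2 a a'" "f' \<in> hom FinSet_over2 a' a''"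
    "g \<in> hom FinSet_over2 b b'" "g' \<in> hom FinSet_over2 b' b''"
  show "tensor_arr FinSet_over2 (f' \<odot>\<^bsub>FinSet_over2\<^esub> f) (g' \<odot>\<^bsub>FinSet_over2\<^esub> g) =
      tensor_arr FinSet_over2 f' g' \<odot>\<^bsub>FinSet_over2\<^esub> tensor_arr FinSet_over2 f g"
    by (rule over2.arrow_eqI, (rule over2_hom_intros fg)+)
      (use fg[THEN over2_homD(3)] fg[THEN over2_homD(4)] fg[THEN over2_homD(5)] in
        \<open>auto simp: over2_sel over2_structure compose_eq elim!: disjoint_sumE\<close>)
next
  fix f g h :: "'a over2_arrow" and a a' b b' c c'
  assume fgh: "f \<in> hom FinSet_over2 a a'" "g \<in> hom FinSet_over2 b b'" "h \<in> hom FinSet_over2 c c'"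
  note obs = fgh[THEN over2_homD(1)] fgh[THEN over2_homD(2)]
  show "associator FinSet_over2 a' b' c' \<odot>\<^bsub>FinSet_over2\<^esub>
        tensor_arr FinSet_over2 (tensor_arr FinSet_over2 f g) h =
      tensor_arr FinSet_over2 f (tensor_arr FinSet_over2 g h) \<odot>\<^bsub>FinSet_over2\<^esub>
        associator FinSet_over2 a b c"
    by (rule over2.arrow_eqI, (rule over2_hom_intros fgh obs)+)
      (use fgh[THEN over2_homD(3)] fgh[THEN over2_homD(4)] fgh[THEN over2_homD(5)] in
        \<open>auto simp: over2_sel over2_structure compose_eq elim!: disjoint_sumE\<close>)
next
  fix f :: "'a over2_arrow" and a a'
  assume f: "f \<in> hom FinSet_over2 a a'"
  note obs = over2_homD(1,2)[OF f]
  show "left_unitor FinSet_over2 a' \<odot>\<^bsub>FinSet_over2\<^esub>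
        tensor_arr FinSet_over2 (Id FinSet_over2 over2_empty) f =
      f \<odot>\<^bsub>FinSet_over2\<^esub> left_unitor FinSet_over2 a"
    by (rule over2.arrow_eqI, (rule over2_hom_intros f obs)+)
      (use over2_homD[OF f] in
        \<open>auto simp: over2_sel over2_structure compose_eq elim!: disjoint_sumE\<close>)
  show "right_unitor FinSet_over2 a' \<odot>\<^bsub>FinSet_over2\<^esub>
        tensor_arr FinSet_over2 f (Id FinSet_over2 over2_empty) =
      f \<odot>\<^bsub>FinSet_over2\<^esub> right_unitor FinSet_over2 a"
    by (rule over2.arrow_eqI, (rule over2_hom_intros f obs)+)
      (use over2_homD[OF f] in
        \<open>auto simp: over2_sel over2_structure compose_eq elim!: disjoint_sumE\<close>)
next
  fix f g :: "'a over2_arrow" and a a' b b'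
  assume fg: "f \<in> hom FinSet_over2 a a'" "g \<in> hom FinSet_over2 b b'"
  note obs = fg[THEN over2_homD(1)] fg[THEN over2_homD(2)]
  show "braiding FinSet_over2 a' b' \<odot>\<^bsub>FinSet_over2\<^esub> tensor_arr FinSet_over2 f g =
      tensor_arr FinSet_over2 g f \<odot>\<^bsub>FinSet_over2\<^esub> braiding FinSet_over2 a b"
    by (rule over2.arrow_eqI, (rule over2_hom_intros fg obs)+)
      (use fg[THEN over2_homD(3)] fg[THEN over2_homD(4)] fg[THEN over2_homD(5)] in
        \<open>auto simp: over2_sel over2_structure compose_eq elim!: disjoint_sumE\<close>)
next
  fix a b :: "'a over2"
  assume obs: "a \<in> over2_obs" "b \<in> over2_obs"
  show "tensor_arr FinSet_over2 (Id FinSet_over2 a) (Id FinSet_over2 b)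
      = Id FinSet_over2 (over2_sum a b)"
    by (rule over2.arrow_eqI, (rule over2_hom_intros obs)+)
      (auto simp: over2_sel over2_structure elim!: disjoint_sumE)
  show "braiding FinSet_over2 b a \<odot>\<^bsub>FinSet_over2\<^esub> braiding FinSet_over2 a b
      = Id FinSet_over2 (over2_sum a b)"
    by (rule over2.arrow_eqI, (rule over2_hom_intros obs)+)
      (auto simp: over2_sel over2_structure compose_eq elim!: disjoint_sumE)
  show "tensor_arr FinSet_over2 (Id FinSet_over2 a) (left_unitor FinSet_over2 b)
        \<odot>\<^bsub>FinSet_over2\<^esub> associator FinSet_over2 a over2_empty b
      = tensor_arr FinSet_over2 (right_unitor FinSet_over2 a) (Id FinSet_over2 b)"
    by (rule over2.arrow_eqI, (rule over2_hom_intros obs)+)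
      (auto simp: over2_sel over2_structure compose_eq elim!: disjoint_sumE)
next
  fix a b c :: "'a over2"
  assume obs: "a \<in> over2_obs" "b \<in> over2_obs" "c \<in> over2_obs"
  show "associator FinSet_over2 b c a \<odot>\<^bsub>FinSet_over2\<^esub>
        braiding FinSet_over2 a (over2_sum b c) \<odot>\<^bsub>FinSet_over2\<^esub> associator FinSet_over2 a b c =
      tensor_arr FinSet_over2 (Id FinSet_over2 b) (braiding FinSet_over2 a c) \<odot>\<^bsub>FinSet_over2\<^esub>
        associator FinSet_over2 b a c \<odot>\<^bsub>FinSet_over2\<^esub>
        tensor_arr FinSet_over2 (braiding FinSet_over2 a b) (Id FinSet_over2 c)"
    by (rule over2.arrow_eqI, (rule over2_hom_intros obs)+)
      (auto simp: over2_sel over2_structure compose_eq elim!: disjoint_sumE)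
next
  fix a b c d :: "'a over2"
  assume obs: "a \<in> over2_obs" "b \<in> over2_obs" "c \<in> over2_obs" "d \<in> over2_obs"
  show "associator FinSet_over2 a b (over2_sum c d) \<odot>\<^bsub>FinSet_over2\<^esub>
        associator FinSet_over2 (over2_sum a b) c d =
      tensor_arr FinSet_over2 (Id FinSet_over2 a) (associator FinSet_over2 b c d) \<odot>\<^bsub>FinSet_over2\<^esub>
        associator FinSet_over2 a (over2_sum b c) d \<odot>\<^bsub>FinSet_over2\<^esub>
        tensor_arr FinSet_over2 (associator FinSet_over2 a b c) (Id FinSet_over2 d)"
    by (rule over2.arrow_eqI, (rule over2_hom_intros obs)+)
      (auto simp: over2_sel over2_structure compose_eq elim!: disjoint_sumE)
qed (simp_all add: over2_sum_obs over2_empty_obs over2_tensor_hom over2_structure_hom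
    over2_associator_iso over2_left_unitor_iso over2_right_unitor_iso)


section \<open>Sets and functions\<close>

lemma Set_sel:
  "Ob Set_category = UNIV"
  "Dom Set_category = src" "Cod Set_category = tgt"
  "Id Set_category A = Arrow A A (\<lambda>x\<in>A. x)"
  "Comp Set_category g f = Arrow (src f) (tgt g) (compose (src f) (app g) (app f))"
  "tensor_ob Set_category = cartesian"
  "unit_ob Set_category = {Star}"
  by (simp_all add: Set_category_def)

lemma Set_Arr_iff: "f \<in> Arr Set_category \<longleftrightarrow> app f \<in> src f \<rightarrow>\<^sub>E tgt f"
  by (cases f) (auto simp: Set_category_def)

lemma Set_structure:
  "tensor_arr Set_category f g = Arrow (cartesian (src f) (src g)) (cartesian (tgt f) (tgt g))
    (\<lambda>z\<in>cartesian (src f) (src g). case z of Tup a b \<Rightarrow> Tup (app f a) (app g b))"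
  "associator Set_category A B D =
    Arrow (cartesian (cartesian A B) D) (cartesian A (cartesian B D))
    (\<lambda>z\<in>cartesian (cartesian A B) D. case z of Tup (Tup a b) c \<Rightarrow> Tup a (Tup b c))"
  "left_unitor Set_category A = Arrow (cartesian {Star} A) A
    (\<lambda>z\<in>cartesian {Star} A. case z of Tup _ a \<Rightarrow> a)"
  "right_unitor Set_category A = Arrow (cartesian A {Star}) A
    (\<lambda>z\<in>cartesian A {Star}. case z of Tup a _ \<Rightarrow> a)"
  "braiding Set_category A B = Arrow (cartesian A B) (cartesian B A)
    (\<lambda>z\<in>cartesian A B. case z of Tup a b \<Rightarrow> Tup b a)"
  by (simp_all add: Set_category_def)

interpretation Set: concrete_category Set_category "\<lambda>A. A"
proof
  fix f g :: "'a set_arrow"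
  assume "f \<in> Arr Set_category" "g \<in> Arr Set_category" "tgt f = src g"
  then show "g \<odot>\<^bsub>Set_category\<^esub> f \<in> Arr Set_category"
    by (simp add: Set_sel Set_Arr_iff compose_def PiE_iff Pi_iff)
qed (auto simp: Set_sel Set_Arr_iff)

lemma Set_homI:
  "\<lbrakk>f \<in> extensional A; \<And>x. x \<in> A \<Longrightarrow> f x \<in> B\<rbrakk> \<Longrightarrow> Arrow A B f \<in> hom Set_category A B"
  by (simp add: Set.hom_iff Set_Arr_iff PiE_def)

lemma Set_homD:
  assumes "f \<in> hom Set_category A B"
  shows "src f = A" "tgt f = B" "\<And>x. x \<in> A \<Longrightarrow> app f x \<in> B"
  using assms by (auto simp: Set.hom_iff Set_Arr_iff)

lemma cartesian_mem [simp]: "Tup a b \<in> cartesian A B \<longleftrightarrow> a \<in> A \<and> b \<in> B"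
  by (auto simp: cartesian_def)

lemma cartesianE:
  assumes "z \<in> cartesian A B"
  obtains a b where "z = Tup a b" "a \<in> A" "b \<in> B"
  using assms by (auto simp: cartesian_def)

lemma Set_tensor_hom:
  assumes "f \<in> hom Set_category A A'" "g \<in> hom Set_category B B'"
  shows "tensor_arr Set_category f g \<in> hom Set_category (cartesian A B) (cartesian A' B')"
  unfolding Set_structure Set_homD[OF assms(1)] Set_homD[OF assms(2)]
  by (rule Set_homI) (use Set_homD[OF assms(1)] Set_homD[OF assms(2)] in \<open>auto elim!: cartesianE\<close>)

lemma Set_structure_hom:
  "associator Set_category A B D
    \<in> hom Set_category (cartesian (cartesian A B) D) (cartesian A (cartesian B D))"
  "left_unitor Set_category A \<in> hom Set_category (cartesian {Star} A) A"
  "right_unitor Set_category A \<in> hom Set_category (cartesian A {Star}) A"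
  "braiding Set_category A B \<in> hom Set_category (cartesian A B) (cartesian B A)"
  unfolding Set_structure by (rule Set_homI; auto elim!: cartesianE)+

lemma Set_Id_hom: "Id Set_category A \<in> hom Set_category A A"
  by (rule Set.Id_in_hom) (simp add: Set_sel)

lemmas Set_hom_intros = Set.Comp_in_hom Set_tensor_hom Set_structure_hom Set_Id_hom

lemma Set_associator_iso:
  "associator Set_category A B D
    \<in> iso Set_category (cartesian (cartesian A B) D) (cartesian A (cartesian B D))"
proof -
  have "Arrow (cartesian A (cartesian B D)) (cartesian (cartesian A B) D)
      (\<lambda>z\<in>cartesian A (cartesian B D). case z of Tup a (Tup b d) \<Rightarrow> Tup (Tup a b) d)
    \<in> hom Set_category (cartesian A (cartesian B D)) (cartesian (cartesian A B) D)"
    by (rule Set_homI) (auto elim!: cartesianE)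
  then show ?thesis
    by (rule Set.isoI[OF Set_structure_hom(1)]) (auto simp: Set_structure elim!: cartesianE)
qed

lemma Set_left_unitor_iso: "left_unitor Set_category A \<in> iso Set_category (cartesian {Star} A) A"
proof -
  have "Arrow A (cartesian {Star} A) (\<lambda>a\<in>A. Tup Star a)
    \<in> hom Set_category A (cartesian {Star} A)"
    by (rule Set_homI) auto
  then show ?thesis
    by (rule Set.isoI[OF Set_structure_hom(2)]) (auto simp: Set_structure elim!: cartesianE)
qed

lemma Set_right_unitor_iso: "right_unitor Set_category A \<in> iso Set_category (cartesian A {Star}) A"
proof -
  have "Arrow A (cartesian A {Star}) (\<lambda>a\<in>A. Tup a Star)
    \<in> hom Set_category A (cartesian A {Star})"
    by (rule Set_homI) auto
  then show ?thesis
    by (rule Set.isoI[OF Set_structure_hom(3)]) (auto simp: Set_structure elim!: cartesianE)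
qed

text \<open>
  The argument is the one for finite sets, with elements that are nested tuples: the structure maps
  only rearrange components.\<close>

lemma Set_category_symmetric_monoidal: "symmetric_monoidal_category Set_category"
proof (unfold_locales, unfold Set_sel(1,6,7))
  fix f f' g g' :: "'a set_arrow" and a a' a'' b b' b''
  assume fg: "f \<in> hom Set_category a a'" "f' \<in> hom Set_category a' a''"
    "g \<in> hom Set_category b b'" "g' \<in> hom Set_category b' b''"
  show "tensor_arr Set_category (f' \<odot>\<^bsub>Set_category\<^esub> f) (g' \<odot>\<^bsub>Set_category\<^esub> g) =
      tensor_arr Set_category f' g' \<odot>\<^bsub>Set_category\<^esub> tensor_arr Set_category f g"
    by (rule Set.arrow_eqI, (rule Set_hom_intros fg)+)
      (use fg[THEN Set_homD(1)] fg[THEN Set_homD(2)] fg[THEN Set_homD(3)] in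
        \<open>auto simp: Set_sel Set_structure compose_eq elim!: cartesianE\<close>)
next
  fix f g h :: "'a set_arrow" and a a' b b' c c'
  assume fgh: "f \<in> hom Set_category a a'" "g \<in> hom Set_category b b'" "h \<in> hom Set_category c c'"
  show "associator Set_category a' b' c' \<odot>\<^bsub>Set_category\<^esub>
        tensor_arr Set_category (tensor_arr Set_category f g) h =
      tensor_arr Set_category f (tensor_arr Set_category g h) \<odot>\<^bsub>Set_category\<^esub>
        associator Set_category a b c"
    by (rule Set.arrow_eqI, (rule Set_hom_intros fgh)+)
      (use fgh[THEN Set_homD(1)] fgh[THEN Set_homD(2)] fgh[THEN Set_homD(3)] in
        \<open>auto simp: Set_sel Set_structure compose_eq elim!: cartesianE\<close>)
next
  fix f :: "'a set_arrow" and a a'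
  assume f: "f \<in> hom Set_category a a'"
  show "left_unitor Set_category a' \<odot>\<^bsub>Set_category\<^esub>
        tensor_arr Set_category (Id Set_category {Star}) f =
      f \<odot>\<^bsub>Set_category\<^esub> left_unitor Set_category a"
    by (rule Set.arrow_eqI, (rule Set_hom_intros f)+)
      (use Set_homD[OF f] in
        \<open>auto simp: Set_sel Set_structure compose_eq elim!: cartesianE\<close>)
  show "right_unitor Set_category a' \<odot>\<^bsub>Set_category\<^esub>
        tensor_arr Set_category f (Id Set_category {Star}) =
      f \<odot>\<^bsub>Set_category\<^esub> right_unitor Set_category a"
    by (rule Set.arrow_eqI, (rule Set_hom_intros f)+)
      (use Set_homD[OF f] in
        \<open>auto simp: Set_sel Set_structure compose_eq elim!: cartesianE\<close>)
next
  fix f g :: "'a set_arrow" and a a' b b'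
  assume fg: "f \<in> hom Set_category a a'" "g \<in> hom Set_category b b'"
  show "braiding Set_category a' b' \<odot>\<^bsub>Set_category\<^esub> tensor_arr Set_category f g =
      tensor_arr Set_category g f \<odot>\<^bsub>Set_category\<^esub> braiding Set_category a b"
    by (rule Set.arrow_eqI, (rule Set_hom_intros fg)+)
      (use fg[THEN Set_homD(1)] fg[THEN Set_homD(2)] fg[THEN Set_homD(3)] in
        \<open>auto simp: Set_sel Set_structure compose_eq elim!: cartesianE\<close>)
next
  fix a b :: "'a element set"
  show "tensor_arr Set_category (Id Set_category a) (Id Set_category b)
      = Id Set_category (cartesian a b)"
    by (rule Set.arrow_eqI, (rule Set_hom_intros)+)
      (auto simp: Set_sel Set_structure elim!: cartesianE)
  show "braiding Set_category b a \<odot>\<^bsub>Set_category\<^esub> braiding Set_category a b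
      = Id Set_category (cartesian a b)"
    by (rule Set.arrow_eqI, (rule Set_hom_intros)+)
      (auto simp: Set_sel Set_structure compose_eq elim!: cartesianE)
  show "tensor_arr Set_category (Id Set_category a) (left_unitor Set_category b)
        \<odot>\<^bsub>Set_category\<^esub> associator Set_category a {Star} b
      = tensor_arr Set_category (right_unitor Set_category a) (Id Set_category b)"
    by (rule Set.arrow_eqI, (rule Set_hom_intros)+)
      (auto simp: Set_sel Set_structure compose_eq elim!: cartesianE)
next
  fix a b c :: "'a element set"
  show "associator Set_category b c a \<odot>\<^bsub>Set_category\<^esub>
        braiding Set_category a (cartesian b c) \<odot>\<^bsub>Set_category\<^esub> associator Set_category a b c =
      tensor_arr Set_category (Id Set_category b) (braiding Set_category a c) \<odot>\<^bsub>Set_category\<^esub>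
        associator Set_category b a c \<odot>\<^bsub>Set_category\<^esub>
        tensor_arr Set_category (braiding Set_category a b) (Id Set_category c)"
    by (rule Set.arrow_eqI, (rule Set_hom_intros)+)
      (auto simp: Set_sel Set_structure compose_eq elim!: cartesianE)
next
  fix a b c d :: "'a element set"
  show "associator Set_category a b (cartesian c d) \<odot>\<^bsub>Set_category\<^esub>
        associator Set_category (cartesian a b) c d =
      tensor_arr Set_category (Id Set_category a) (associator Set_category b c d) \<odot>\<^bsub>Set_category\<^esub>
        associator Set_category a (cartesian b c) d \<odot>\<^bsub>Set_category\<^esub>
        tensor_arr Set_category (associator Set_category a b c) (Id Set_category d)"
    by (rule Set.arrow_eqI, (rule Set_hom_intros)+)
      (auto simp: Set_sel Set_structure compose_eq elim!: cartesianE)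
qed (simp_all add: Set_tensor_hom Set_structure_hom
    Set_associator_iso Set_left_unitor_iso Set_right_unitor_iso)


section \<open>Saddle functions\<close>

lemma convex_Rn: "convex (Rn N)"
  by (auto simp: convex_def Rn_def scaleR_fun_def)

lemma pullback_linear:
  "pullback N \<phi> (u *\<^sub>R x + v *\<^sub>R y) = u *\<^sub>R pullback N \<phi> x + v *\<^sub>R pullback N \<phi> y"
  by (simp add: fun_eq_iff pullback_def scaleR_fun_def)

lemma pullback_in_Rn [simp]: "pullback N \<phi> y \<in> Rn N"
  by (simp add: pullback_def Rn_def)

lemma pullback_pullback:
  "(\<And>i. i \<in> N \<Longrightarrow> \<phi> i \<in> M) \<Longrightarrow> pullback N \<phi> (pullback M \<psi> y) = pullback N (\<lambda>i. \<psi> (\<phi> i)) y"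
  by (auto simp: pullback_def)

lemma pullback_cong: "(\<And>i. i \<in> N \<Longrightarrow> \<phi> i = \<psi> i) \<Longrightarrow> pullback N \<phi> y = pullback N \<psi> y"
  by (auto simp: pullback_def)

lemma pullback_id: "y \<in> Rn N \<Longrightarrow> (\<And>i. i \<in> N \<Longrightarrow> \<phi> i = i) \<Longrightarrow> pullback N \<phi> y = y"
  by (auto simp: pullback_def Rn_def)

text \<open>
  Being linear, the pullback sends convex combinations to convex combinations.\<close>

lemma convex_on_pullback:
  "convex_on (Rn N) f \<Longrightarrow> convex_on (Rn M) (\<lambda>y. f (pullback N \<phi> y))"
  by (simp add: convex_on_def pullback_linear convex_Rn)

lemma concave_on_pullback:
  "concave_on (Rn N) f \<Longrightarrow> concave_on (Rn M) (\<lambda>y. f (pullback N \<phi> y))"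
  unfolding concave_on_def by (rule convex_on_pullback)

text \<open>
  The saddle condition without extensionality. Sums and pullbacks of extensional functions
  need not be extensional, so closure properties are proved for this predicate and
  transferred by \<open>restrict_in_saddle_functions\<close>.\<close>

definition saddle_shaped :: "'a over2 \<Rightarrow> (('a point \<Rightarrow> real) \<Rightarrow> real) \<Rightarrow> bool" where
  "saddle_shaped T f \<longleftrightarrow>
    (\<forall>y \<in> Rn (label_fibre T 2).
       convex_on (Rn (label_fibre T 1)) (\<lambda>x. f (join (label_fibre T 1) (label_fibre T 2) x y))) \<and>
    (\<forall>x \<in> Rn (label_fibre T 1).
       concave_on (Rn (label_fibre T 2)) (\<lambda>y. f (join (label_fibre T 1) (label_fibre T 2) x y)))"

lemma saddle_functions_iff:
  "f \<in> saddle_functions T \<longleftrightarrow> f \<in> extensional (Rn (fst T)) \<and> saddle_shaped T f"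
  by (simp add: saddle_functions_def saddle_shaped_def Let_def)

lemma saddle_functions_extensional: "f \<in> saddle_functions T \<Longrightarrow> f \<in> extensional (Rn (fst T))"
  by (simp add: saddle_functions_iff)

text \<open>
  The condition only sees values at joined vectors, and these lie in \<open>\<real>\<^sup>N\<close>.\<close>

lemma restrict_in_saddle_functions:
  "restrict f (Rn (fst T)) \<in> saddle_functions T \<longleftrightarrow> saddle_shaped T f"
proof -
  have "join (label_fibre T 1) (label_fibre T 2) x y \<in> Rn (fst T)" for x y
    by (auto simp: join_def Rn_def label_fibre_def)
  then show ?thesis
    by (simp add: saddle_functions_iff saddle_shaped_def)
qed

lemma saddle_shaped_const: "saddle_shaped T (\<lambda>_. c)"
  by (simp add: saddle_shaped_def convex_on_const concave_on_const convex_Rn)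

lemma saddle_shaped_add:
  "\<lbrakk>saddle_shaped T f; saddle_shaped T g\<rbrakk> \<Longrightarrow> saddle_shaped T (\<lambda>z. f z + g z)"
  by (simp add: saddle_shaped_def convex_on_add concave_on_add)

text \<open>
  A coordinate \<open>i\<close> of \<open>S\<close> reads the coordinate \<open>\<phi> i\<close>, which carries the same label; hence convex
  coordinates read from \<open>x\<close> only and concave ones from \<open>y\<close> only. This is where preservation
  of labels enters.\<close>

lemma pullback_join:
  assumes "\<And>i. i \<in> fst S \<Longrightarrow> \<phi> i \<in> fst T \<and> snd T (\<phi> i) = snd S i"
  shows "pullback (fst S) \<phi> (join (label_fibre T 1) (label_fibre T 2) x y) =
    join (label_fibre S 1) (label_fibre S 2)
      (pullback (label_fibre S 1) \<phi> x) (pullback (label_fibre S 2) \<phi> y)"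
  using assms by (auto simp: fun_eq_iff pullback_def join_def label_fibre_def)

text \<open>
  With one block fixed, its pullback is fixed too, and the other block enters through a linear map.\<close>

lemma saddle_shaped_pullback:
  assumes "saddle_shaped S f"
    and "\<And>i. i \<in> fst S \<Longrightarrow> \<phi> i \<in> fst T \<and> snd T (\<phi> i) = snd S i"
  shows "saddle_shaped T (\<lambda>z. f (pullback (fst S) \<phi> z))"
proof -
  have join: "pullback (fst S) \<phi> (join (label_fibre T 1) (label_fibre T 2) x y) =
      join (label_fibre S 1) (label_fibre S 2)
        (pullback (label_fibre S 1) \<phi> x) (pullback (label_fibre S 2) \<phi> y)" for x y
    by (rule pullback_join) (rule assms(2))
  show ?thesis
    unfolding saddle_shaped_def
  proof (intro conjI ballI)
    fix y :: "'b point \<Rightarrow> real"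
    let ?y = "pullback (label_fibre S 2) \<phi> y"
    have "convex_on (Rn (label_fibre S 1))
        (\<lambda>x. f (join (label_fibre S 1) (label_fibre S 2) x ?y))"
      using assms(1) by (simp add: saddle_shaped_def)
    then show "convex_on (Rn (label_fibre T 1))
        (\<lambda>x. f (pullback (fst S) \<phi> (join (label_fibre T 1) (label_fibre T 2) x y)))"
      unfolding join by (rule convex_on_pullback)
  next
    fix x :: "'b point \<Rightarrow> real"
    let ?x = "pullback (label_fibre S 1) \<phi> x"
    have "concave_on (Rn (label_fibre S 2))
        (\<lambda>y. f (join (label_fibre S 1) (label_fibre S 2) ?x y))"
      using assms(1) by (simp add: saddle_shaped_def)
    then show "concave_on (Rn (label_fibre T 2))
        (\<lambda>y. f (pullback (fst S) \<phi> (join (label_fibre T 1) (label_fibre T 2) x y)))"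
      unfolding join by (rule concave_on_pullback)
  qed
qed

text \<open>
  The action of a morphism and the product comparison on plain functions, freed from the tags
  of the universe of sets.\<close>

definition pushforward :: "'i set \<Rightarrow> 'j set \<Rightarrow> ('i \<Rightarrow> 'j)
    \<Rightarrow> (('i \<Rightarrow> real) \<Rightarrow> real) \<Rightarrow> ('j \<Rightarrow> real) \<Rightarrow> real" where
  "pushforward N M \<phi> f = (\<lambda>z\<in>Rn M. f (pullback N \<phi> z))"

definition external_sum :: "'a point set \<Rightarrow> 'a point set
    \<Rightarrow> (('a point \<Rightarrow> real) \<Rightarrow> real) \<Rightarrow> (('a point \<Rightarrow> real) \<Rightarrow> real) \<Rightarrow> ('a point \<Rightarrow> real) \<Rightarrow> real" where
  "external_sum N M f g =
    (\<lambda>z\<in>Rn (disjoint_sum N M). f (pullback N InL z) + g (pullback M InR z))"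

lemma pushforward_saddle:
  assumes "\<phi> \<in> hom FinSet_over2 S T" "f \<in> saddle_functions S"
  shows "pushforward (fst S) (fst T) (app \<phi>) f \<in> saddle_functions T"
  using assms(2) over2_homD[OF assms(1)] unfolding pushforward_def restrict_in_saddle_functions
  by (intro saddle_shaped_pullback) (auto simp: saddle_functions_iff)

text \<open>
  Both summands are pullbacks along label preserving maps, namely the two inclusions.
  The index sets are variables of their own so that the rule still applies when \<open>S\<close> or \<open>T\<close> is
  itself a sum and its index set has been simplified.\<close>

lemma external_sum_saddle:
  assumes "f \<in> saddle_functions S" "g \<in> saddle_functions T" "N = fst S" "M = fst T"
  shows "external_sum N M f g \<in> saddle_functions (over2_sum S T)"
proof -
  have "saddle_shaped (over2_sum S T) (\<lambda>z. f (pullback N InL z))"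
    "saddle_shaped (over2_sum S T) (\<lambda>z. g (pullback M InR z))"
    using assms by (auto intro!: saddle_shaped_pullback simp: saddle_functions_iff)
  from saddle_shaped_add[OF this] show ?thesis
    by (simp add: external_sum_def assms(3,4) flip: restrict_in_saddle_functions)
qed

lemma zero_saddle: "(\<lambda>z\<in>Rn {}. 0) \<in> saddle_functions over2_empty"
  using restrict_in_saddle_functions[of "\<lambda>_. 0" over2_empty] by (simp add: saddle_shaped_const)

lemma pushforward_id:
  assumes "f \<in> saddle_functions T"
  shows "pushforward (fst T) (fst T) (\<lambda>i\<in>fst T. i) f = f"
  by (rule extensionalityI[where A = "Rn (fst T)"])
    (use assms in \<open>auto simp: pushforward_def pullback_id saddle_functions_iff\<close>)

text \<open>
  This identity and the laws of the external sum below hold because iterated pullbacks merge into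
  one, along the composite index map; it remains to compare index maps on the index set.\<close>

lemma pushforward_compose:
  assumes "\<And>i. i \<in> N \<Longrightarrow> \<phi> i \<in> M"
  shows "pushforward M K \<psi> (pushforward N M \<phi> f) = pushforward N K (compose N \<psi> \<phi>) f"
  using assms
  by (simp add: pushforward_def pullback_pullback compose_eq cong: pullback_cong restrict_cong)

lemma external_sum_natural:
  assumes "\<And>i. i \<in> N \<Longrightarrow> \<phi> i \<in> N'" "\<And>j. j \<in> M \<Longrightarrow> \<psi> j \<in> M'"
  shows "external_sum N' M' (pushforward N N' \<phi> f) (pushforward M M' \<psi> g) =
    pushforward (disjoint_sum N M) (disjoint_sum N' M') (copair N M (InL \<circ> \<phi>) (InR \<circ> \<psi>))
      (external_sum N M f g)"
  using assms
  by (simp add: pushforward_def external_sum_def pullback_pullback cong: pullback_cong restrict_cong)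

lemma external_sum_assoc:
  "pushforward (disjoint_sum (disjoint_sum N M) K) (disjoint_sum N (disjoint_sum M K))
      (copair (disjoint_sum N M) K (copair N M InL (InR \<circ> InL)) (InR \<circ> InR))
      (external_sum (disjoint_sum N M) K (external_sum N M f g) h) =
    external_sum N (disjoint_sum M K) f (external_sum M K g h)"
  by (simp add: pushforward_def external_sum_def pullback_pullback add.assoc
      cong: pullback_cong restrict_cong)

lemma external_sum_commute:
  "pushforward (disjoint_sum N M) (disjoint_sum M N) (copair N M InR InL) (external_sum N M f g) =
    external_sum M N g f"
  by (simp add: pushforward_def external_sum_def pullback_pullback add.commute
      cong: pullback_cong restrict_cong)

lemma external_sum_zero_left:
  assumes "f \<in> extensional (Rn N)"
  shows "pushforward (disjoint_sum {} N) N (copair {} N (\<lambda>_. undefined) (\<lambda>i. i))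
      (external_sum {} N (\<lambda>z\<in>Rn {}. 0) f) = f"
  by (rule extensionalityI[where A = "Rn N"])
    (use assms in \<open>simp_all add: pushforward_def external_sum_def pullback_pullback pullback_id
       cong: pullback_cong\<close>)

lemma external_sum_zero_right:
  assumes "f \<in> extensional (Rn N)"
  shows "pushforward (disjoint_sum N {}) N (copair N {} (\<lambda>i. i) (\<lambda>_. undefined))
      (external_sum N {} f (\<lambda>z\<in>Rn {}. 0)) = f"
  by (rule extensionalityI[where A = "Rn N"])
    (use assms in \<open>simp_all add: pushforward_def external_sum_def pullback_pullback pullback_id
       cong: pullback_cong\<close>)


section \<open>The lax monoidal functor\<close>

lemma saddle_ob_mem [simp]: "Fn f \<in> saddle_ob T \<longleftrightarrow> f \<in> saddle_functions T"
  by (auto simp: saddle_ob_def)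

lemma saddle_obE:
  assumes "z \<in> saddle_ob T"
  obtains f where "z = Fn f" "f \<in> saddle_functions T"
  using assms by (auto simp: saddle_ob_def)

lemma saddle_arr_sel:
  "src (saddle_arr \<phi>) = saddle_ob (src \<phi>)" "tgt (saddle_arr \<phi>) = saddle_ob (tgt \<phi>)"
  "f \<in> saddle_functions (src \<phi>) \<Longrightarrow> app (saddle_arr \<phi>) (Fn f) =
     Fn (pushforward (fst (src \<phi>)) (fst (tgt \<phi>)) (app \<phi>) f)"
  by (simp_all add: saddle_arr_def pushforward_def compose_def)

lemma saddle_mult_sel:
  "src (saddle_mult S T) = cartesian (saddle_ob S) (saddle_ob T)"
  "tgt (saddle_mult S T) = saddle_ob (over2_sum S T)"
  "\<lbrakk>f \<in> saddle_functions S; g \<in> saddle_functions T\<rbrakk> \<Longrightarrow>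
     app (saddle_mult S T) (Tup (Fn f) (Fn g)) = Fn (external_sum (fst S) (fst T) f g)"
  by (simp_all add: saddle_mult_def external_sum_def)

lemma saddle_unit_sel:
  "src saddle_unit = {Star}" "tgt saddle_unit = saddle_ob over2_empty"
  "app saddle_unit Star = Fn (\<lambda>z\<in>Rn {}. 0)"
  by (simp_all add: saddle_unit_def)

lemma saddle_arr_hom:
  assumes "\<phi> \<in> hom FinSet_over2 S T"
  shows "saddle_arr \<phi> \<in> hom Set_category (saddle_ob S) (saddle_ob T)"
proof -
  have "app (saddle_arr \<phi>) \<in> extensional (saddle_ob S)"
    using over2_homD(3)[OF assms] by (simp add: saddle_arr_def)
  then show ?thesis
    using pushforward_saddle[OF assms] over2_homD(3,4)[OF assms]
    by (auto simp: Set.hom_iff Set_Arr_iff PiE_iff saddle_arr_sel elim!: saddle_obE)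
qed

lemma saddle_mult_hom:
  "saddle_mult S T
    \<in> hom Set_category (cartesian (saddle_ob S) (saddle_ob T)) (saddle_ob (over2_sum S T))"
proof -
  have "app (saddle_mult S T) \<in> extensional (cartesian (saddle_ob S) (saddle_ob T))"
    by (simp add: saddle_mult_def)
  then show ?thesis
    by (auto simp: Set.hom_iff Set_Arr_iff PiE_iff saddle_mult_sel external_sum_saddle
        elim!: saddle_obE cartesianE)
qed

lemma saddle_unit_hom: "saddle_unit \<in> hom Set_category {Star} (saddle_ob over2_empty)"
  unfolding saddle_unit_def by (rule Set_homI) (auto simp: zero_saddle)

lemmas saddle_sel = saddle_arr_sel saddle_mult_sel saddle_unit_sel

lemmas saddle_homs = saddle_arr_hom saddle_mult_hom saddle_unit_hom

theorem lemma4p3: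
  shows "lax_symmetric_monoidal_functor
    (FinSet_over2 :: ('a over2, 'a over2_arrow) monoidal_category)
    (Set_category :: (('a, 'b) saddle_element set, ('a, 'b) saddle_arrow) monoidal_category)
    saddle_ob saddle_arr saddle_mult saddle_unit"
  \<comment> \<open>Evaluated at a tuple of saddle functions, each coherence law in \<open>Set_category\<close> becomes
    one of the identities for \<open>pushforward\<close> and \<open>external_sum\<close>.\<close>
proof (intro lax_symmetric_monoidal_functor.intro lax_symmetric_monoidal_functor_axioms.intro
    FinSet_over2_symmetric_monoidal Set_category_symmetric_monoidal,
    unfold over2_sel(1,7,8) Set_sel(1,6,7))
  fix S :: "'a over2"
  assume S: "S \<in> over2_obs"
  have Id: "Id FinSet_over2 S \<in> hom FinSet_over2 S S"
    by (rule over2_hom_intros S)+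
  show "saddle_arr (Id FinSet_over2 S) = Id Set_category (saddle_ob S)"
    by (rule Set.arrow_eqI, (rule Set_hom_intros saddle_homs Id)+)
      (auto simp: Set_sel over2_sel saddle_arr_sel pushforward_id elim!: saddle_obE)
  show "saddle_arr (left_unitor FinSet_over2 S) \<odot>\<^bsub>Set_category\<^esub>
        saddle_mult over2_empty S \<odot>\<^bsub>Set_category\<^esub>
        tensor_arr Set_category saddle_unit (Id Set_category (saddle_ob S)) =
      left_unitor Set_category (saddle_ob S)"
    by (rule Set.arrow_eqI, (rule Set_hom_intros saddle_homs over2_hom_intros S)+)
      (auto simp: Set_sel Set_structure over2_sel over2_structure saddle_sel
        compose_eq external_sum_saddle zero_saddle external_sum_zero_left saddle_functions_extensional
        elim!: cartesianE saddle_obE)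
  show "saddle_arr (right_unitor FinSet_over2 S) \<odot>\<^bsub>Set_category\<^esub>
        saddle_mult S over2_empty \<odot>\<^bsub>Set_category\<^esub>
        tensor_arr Set_category (Id Set_category (saddle_ob S)) saddle_unit =
      right_unitor Set_category (saddle_ob S)"
    by (rule Set.arrow_eqI, (rule Set_hom_intros saddle_homs over2_hom_intros S)+)
      (auto simp: Set_sel Set_structure over2_sel over2_structure saddle_sel
        compose_eq external_sum_saddle zero_saddle external_sum_zero_right saddle_functions_extensional
        elim!: cartesianE saddle_obE)
next
  fix f g :: "'a over2_arrow" and S T U
  assume fg: "f \<in> hom FinSet_over2 S T" "g \<in> hom FinSet_over2 T U"
  show "saddle_arr (g \<odot>\<^bsub>FinSet_over2\<^esub> f) = saddle_arr g \<odot>\<^bsub>Set_category\<^esub> saddle_arr f"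
    by (rule Set.arrow_eqI, (rule Set_hom_intros saddle_homs over2_hom_intros fg)+)
      (auto simp: fg[THEN over2_homD(3)] fg[THEN over2_homD(4)] fg[THEN over2_homD(5)]
        Set_sel Set_structure over2_sel over2_structure saddle_sel
        compose_eq pushforward_compose pushforward_saddle[OF fg(1)]
        elim!: cartesianE saddle_obE)
next
  fix f g :: "'a over2_arrow" and S S' T T'
  assume fg: "f \<in> hom FinSet_over2 S S'" "g \<in> hom FinSet_over2 T T'"
  show "saddle_mult S' T' \<odot>\<^bsub>Set_category\<^esub> tensor_arr Set_category (saddle_arr f) (saddle_arr g) =
      saddle_arr (tensor_arr FinSet_over2 f g) \<odot>\<^bsub>Set_category\<^esub> saddle_mult S T"
    by (rule Set.arrow_eqI, (rule Set_hom_intros saddle_homs over2_hom_intros fg)+)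
      (auto simp: fg[THEN over2_homD(3)] fg[THEN over2_homD(4)] fg[THEN over2_homD(5)]
        Set_sel Set_structure over2_sel over2_structure saddle_sel
        compose_eq external_sum_natural external_sum_saddle fg[THEN pushforward_saddle]
        elim!: cartesianE saddle_obE)
next
  fix S T U :: "'a over2"
  assume obs: "S \<in> over2_obs" "T \<in> over2_obs" "U \<in> over2_obs"
  show "saddle_arr (associator FinSet_over2 S T U) \<odot>\<^bsub>Set_category\<^esub>
        saddle_mult (over2_sum S T) U \<odot>\<^bsub>Set_category\<^esub>
        tensor_arr Set_category (saddle_mult S T) (Id Set_category (saddle_ob U)) =
      saddle_mult S (over2_sum T U) \<odot>\<^bsub>Set_category\<^esub>
        tensor_arr Set_category (Id Set_category (saddle_ob S)) (saddle_mult T U) \<odot>\<^bsub>Set_category\<^esub>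
        associator Set_category (saddle_ob S) (saddle_ob T) (saddle_ob U)"
    by (rule Set.arrow_eqI, (rule Set_hom_intros saddle_homs over2_hom_intros obs)+)
      (auto simp: Set_sel Set_structure over2_sel over2_structure saddle_sel
        compose_eq external_sum_assoc external_sum_saddle
        elim!: cartesianE saddle_obE)
next
  fix S T :: "'a over2"
  assume obs: "S \<in> over2_obs" "T \<in> over2_obs"
  show "saddle_arr (braiding FinSet_over2 S T) \<odot>\<^bsub>Set_category\<^esub> saddle_mult S T =
      saddle_mult T S \<odot>\<^bsub>Set_category\<^esub> braiding Set_category (saddle_ob S) (saddle_ob T)"
    by (rule Set.arrow_eqI, (rule Set_hom_intros saddle_homs over2_hom_intros obs)+)
      (auto simp: Set_sel Set_structure over2_sel over2_structure saddle_sel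
        compose_eq external_sum_commute external_sum_saddle
        elim!: cartesianE saddle_obE)
qed (simp_all add: saddle_homs)

end
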